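(* Let $A$ be a set of atoms. For all terms $s,t$ (possibly containing variables) over the signature $\Sigma^{\mathsf U}_{\mathrm{SCL}}(A)=\{\wedge,\vee,\neg,\mathsf T,\mathsf F,\mathsf U\}\cup A$, $$\mathrm{CL}_3\vdash s=t\iff \mathrm{C\ell SCL}\vdash s=t.$$
   Context: $\vdash$ denotes derivability in equational logic (variables in axioms may be instantiated by arbitrary terms). Here $\wedge,\vee$ are binary symbols for the (noncommutative) short-circuit conjunction and disjunction, $\neg$ is unary, and $\mathsf T,\mathsf F,\mathsf U$ and all atoms $a\in A$ are constants. $\mathrm{CL}_3$ is the equational theory with the axioms: (a) $\neg\neg x=x$; (b) $\neg(x\wedge y)=\neg x\vee\neg y$; (c) $(x\wedge y)\wedge z=x\wedge(y\wedge z)$; (d) $x\wedge(y\vee z)=(x\wedge y)\vee(x\wedge z)$; (e) $(x\vee y)\wedge z=(x\wedge z)\vee(\neg x\wedge y\wedge z)$ (bracketing immaterial by (c)); (f) $x\vee(x\wedge y)=x$; (g) $(x\wedge y)\vee(y\wedge x)=(y\wedge x)\vee(x\wedge y)$; together with $\mathsf T\wedge x=x$, $\neg\mathsf T=\mathsf F$ and $\neg\mathsf U=\mathsf U$. The ternary conditional is written $x\lhd y\rhd z$ ("if $y$ then $x$ else $z$"). $\mathrm{CP}$ consists of: $x\lhd\mathsf T\rhd y=x$; $x\lhd\mathsf F\rhd y=y$; $\mathsf T\lhd x\rhd\mathsf F=x$; $x\lhd(y\lhd z\rhd u)\rhd v=(x\lhd y\rhd v)\lhd z\rhd(x\lhd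 u\rhd v)$. $\mathrm{CP}_{mem}$ is $\mathrm{CP}$ plus $x\lhd y\rhd(z\lhd u\rhd(v\lhd y\rhd w))=x\lhd y\rhd(z\lhd u\rhd w)$. $\mathrm{CP}_{cl}$ is $\mathrm{CP}_{mem}$ plus $(x\lhd y\rhd z)\lhd u\rhd(v\lhd y\rhd w)=(x\lhd u\rhd v)\lhd y\rhd(z\lhd u\rhd w)$. $\mathrm{CP}_{cl}^{\mathsf U}$ is $\mathrm{CP}_{cl}$ plus $x\lhd\mathsf U\rhd y=\mathsf U$. $\mathrm{C\ell SCL}$ (conditional short-circuit logic with undefinedness) is the set of consequences, restricted to the signature without the conditional, of $\mathrm{CP}_{cl}^{\mathsf U}\cup\{\neg x=\mathsf F\lhd x\rhd\mathsf T,\ x\wedge y=y\lhd x\rhd\mathsf F\}$, where additionally $\mathsf F=\neg\mathsf T$ and $x\vee y=\neg(\neg x\wedge\neg y)$. That is, for terms $s,t$ over $\Sigma^{\mathsf U}_{\mathrm{SCL}}(A)$, $\mathrm{C\ell SCL}\vdash s=t$ means that $s=t$ is derivable from all these equations in the combined signature. *)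

theory Defs
  imports Main
begin

text \<open>
  Terms over the combined signature: short-circuit connectives, the constants for truth, falsehood
  and undefinedness, the atoms, and Hoare's ternary conditional.  The variables come from a fixed
  countably infinite set.  The middle argument of \<open>x \<lhd> y \<rhd> z\<close> is the condition.
\<close>

datatype (atoms: 'a) trm =
    Var nat
  | Atom 'a
  | T
  | F
  | U
  | Neg "'a trm"  (\<open>\<^bold>\<not> _\<close> [90] 90)
  | And "'a trm" "'a trm"  (infixr \<open>\<^bold>\<and>\<close> 85)
  | Or "'a trm" "'a trm"  (infixr \<open>\<^bold>\<or>\<close> 80)
  | Cond "'a trm" "'a trm" "'a trm"  (\<open>_ \<lhd> _ \<rhd> _\<close> [76, 76, 76] 75)

primrec cond_free :: "'a trm \<Rightarrow> bool" where
  "cond_free (Var n) = True"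
| "cond_free (Atom a) = True"
| "cond_free T = True"
| "cond_free F = True"
| "cond_free U = True"
| "cond_free (\<^bold>\<not> s) = cond_free s"
| "cond_free (s \<^bold>\<and> t) = (cond_free s \<and> cond_free t)"
| "cond_free (s \<^bold>\<or> t) = (cond_free s \<and> cond_free t)"
| "cond_free (s \<lhd> t \<rhd> u) = False"

text \<open>
  The set of atoms is a set rather than the whole type, so that it may be empty.
\<close>

definition scl_terms :: "'a set \<Rightarrow> 'a trm set" where
  "scl_terms A = {t. atoms t \<subseteq> A \<and> cond_free t}"

definition cond_terms :: "'a set \<Rightarrow> 'a trm set" where
  "cond_terms A = {t. atoms t \<subseteq> A}"

primrec subst :: "(nat \<Rightarrow> 'a trm) \<Rightarrow> 'a trm \<Rightarrow> 'a trm" where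
  "subst \<sigma> (Var n) = \<sigma> n"
| "subst \<sigma> (Atom a) = Atom a"
| "subst \<sigma> T = T"
| "subst \<sigma> F = F"
| "subst \<sigma> U = U"
| "subst \<sigma> (\<^bold>\<not> s) = \<^bold>\<not> subst \<sigma> s"
| "subst \<sigma> (s \<^bold>\<and> t) = subst \<sigma> s \<^bold>\<and> subst \<sigma> t"
| "subst \<sigma> (s \<^bold>\<or> t) = subst \<sigma> s \<^bold>\<or> subst \<sigma> t"
| "subst \<sigma> (s \<lhd> t \<rhd> u) = subst \<sigma> s \<lhd> subst \<sigma> t \<rhd> subst \<sigma> u"

type_synonym 'a equation = "'a trm \<times> 'a trm"

text \<open>
  Derivability in equational logic from the axioms \<open>E\<close>, where \<open>S\<close> is the set of all terms over the
  signature at hand: every term occurring in a derivation belongs to \<open>S\<close>.  The side condition of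
  \<open>cond\<close> disables that rule when the signature lacks the conditional; the other connectives belong
  to both signatures considered here.
\<close>

inductive derivable :: "'a trm set \<Rightarrow> 'a equation set \<Rightarrow> 'a trm \<Rightarrow> 'a trm \<Rightarrow> bool"
  for S :: "'a trm set" and E :: "'a equation set" where
  ax: "(l, r) \<in> E \<Longrightarrow> range \<sigma> \<subseteq> S \<Longrightarrow> derivable S E (subst \<sigma> l) (subst \<sigma> r)"
| refl: "t \<in> S \<Longrightarrow> derivable S E t t"
| sym: "derivable S E s t \<Longrightarrow> derivable S E t s"
| trans: "derivable S E s t \<Longrightarrow> derivable S E t u \<Longrightarrow> derivable S E s u"
| neg: "derivable S E s s' \<Longrightarrow> derivable S E (\<^bold>\<not> s) (\<^bold>\<not> s')"
| conj: "derivable S E s s' \<Longrightarrow> derivable S E t t' \<Longrightarrow> derivable S E (s \<^bold>\<and> t) (s' \<^bold>\<and> t')"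
| disj: "derivable S E s s' \<Longrightarrow> derivable S E t t' \<Longrightarrow> derivable S E (s \<^bold>\<or> t) (s' \<^bold>\<or> t')"
| cond: "derivable S E s s' \<Longrightarrow> derivable S E t t' \<Longrightarrow> derivable S E u u' \<Longrightarrow>
    s \<lhd> t \<rhd> u \<in> S \<Longrightarrow> derivable S E (s \<lhd> t \<rhd> u) (s' \<lhd> t' \<rhd> u')"

definition CL3 :: "'a equation set" where
  "CL3 = (let x = Var 0; y = Var 1; z = Var 2 in
    {(\<^bold>\<not> (\<^bold>\<not> x), x),
     (\<^bold>\<not> (x \<^bold>\<and> y), (\<^bold>\<not> x) \<^bold>\<or> (\<^bold>\<not> y)),
     ((x \<^bold>\<and> y) \<^bold>\<and> z, x \<^bold>\<and> (y \<^bold>\<and> z)),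
     (x \<^bold>\<and> (y \<^bold>\<or> z), (x \<^bold>\<and> y) \<^bold>\<or> (x \<^bold>\<and> z)),
     ((x \<^bold>\<or> y) \<^bold>\<and> z, (x \<^bold>\<and> z) \<^bold>\<or> ((\<^bold>\<not> x) \<^bold>\<and> (y \<^bold>\<and> z))),
     (x \<^bold>\<or> (x \<^bold>\<and> y), x),
     ((x \<^bold>\<and> y) \<^bold>\<or> (y \<^bold>\<and> x), (y \<^bold>\<and> x) \<^bold>\<or> (x \<^bold>\<and> y)),
     (T \<^bold>\<and> x, x),
     (\<^bold>\<not> T, F),
     (\<^bold>\<not> U, U)})"

definition CP :: "'a equation set" where
  "CP = (let x = Var 0; y = Var 1; z = Var 2; u = Var 3; v = Var 4 in
    {(x \<lhd> T \<rhd> y, x),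
     (x \<lhd> F \<rhd> y, y),
     (T \<lhd> x \<rhd> F, x),
     (x \<lhd> (y \<lhd> z \<rhd> u) \<rhd> v, (x \<lhd> y \<rhd> v) \<lhd> z \<rhd> (x \<lhd> u \<rhd> v))})"

definition CP_mem :: "'a equation set" where
  "CP_mem = CP \<union>
    (let x = Var 0; y = Var 1; z = Var 2; u = Var 3; v = Var 4; w = Var 5 in
    {(x \<lhd> y \<rhd> (z \<lhd> u \<rhd> (v \<lhd> y \<rhd> w)), x \<lhd> y \<rhd> (z \<lhd> u \<rhd> w))})"

definition CP_cl :: "'a equation set" where
  "CP_cl = CP_mem \<union>
    (let x = Var 0; y = Var 1; z = Var 2; u = Var 3; v = Var 4; w = Var 5 in
    {((x \<lhd> y \<rhd> z) \<lhd> u \<rhd> (v \<lhd> y \<rhd> w), (x \<lhd> u \<rhd> v) \<lhd> y \<rhd> (z \<lhd> u \<rhd> w))})"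

definition CP_cl_U :: "'a equation set" where
  "CP_cl_U = CP_cl \<union> (let x = Var 0; y = Var 1 in {(x \<lhd> U \<rhd> y, U)})"

definition ClSCL_axioms :: "'a equation set" where
  "ClSCL_axioms = CP_cl_U \<union>
    (let x = Var 0; y = Var 1 in
    {(\<^bold>\<not> x, F \<lhd> x \<rhd> T),
     (x \<^bold>\<and> y, y \<lhd> x \<rhd> F),
     (F, \<^bold>\<not> T),
     (x \<^bold>\<or> y, \<^bold>\<not> ((\<^bold>\<not> x) \<^bold>\<and> (\<^bold>\<not> y)))})"

definition CL3_derives :: "'a set \<Rightarrow> 'a trm \<Rightarrow> 'a trm \<Rightarrow> bool" where
  "CL3_derives A s t \<longleftrightarrow> derivable (scl_terms A) CL3 s t"

text \<open>
  Only the endpoints are restricted to the signature without the conditional; derivations may pass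
  through arbitrary terms of the combined signature.
\<close>

definition ClSCL_derives :: "'a set \<Rightarrow> 'a trm \<Rightarrow> 'a trm \<Rightarrow> bool" where
  "ClSCL_derives A s t \<longleftrightarrow>
    s \<in> scl_terms A \<and> t \<in> scl_terms A \<and> derivable (cond_terms A) ClSCL_axioms s t"

end

theory Submission imports Defs begin

text \<open>
  Both directions are inter-derivability of axioms, carried out in quotients of the term algebra.
  From \<open>CP_cl_U\<close> the axioms of \<open>CL3\<close> follow by short computations with the conditional.  Conversely,
  in \<open>CL3\<close> the term \<open>(y \<and> x) \<or> (\<not> y \<and> z)\<close> behaves as the conditional \<open>x \<lhd> y \<rhd> z\<close>; the only
  axiom that is not routine is the one that swaps two conditions.  There, both sides \<open>L\<close> and \<open>R\<close>
  satisfy \<open>R = (y \<or> \<not> y) \<and> L\<close> and \<open>L = (a \<or> \<not> a) \<and> R\<close>, and elements of the form \<open>a \<or> \<not> a\<close> commute.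
\<close>

section \<open>Conditional algebras\<close>

text \<open>The models of \<open>ClSCL_axioms\<close>. The quotient \<open>cond_term\<close> becomes
  an instance below, so that derivations turn into ordinary equational reasoning.\<close>

locale cond_algebra =
  fixes cnd :: "'q \<Rightarrow> 'q \<Rightarrow> 'q \<Rightarrow> 'q" and t f u :: 'q
    and neg :: "'q \<Rightarrow> 'q" (\<open>\<sim> _\<close> [80] 80)
    and conj (infixr \<open>\<sqinter>\<close> 70) and disj (infixr \<open>\<squnion>\<close> 65)
  assumes cnd_t: "cnd x t y = x" and cnd_f: "cnd x f y = y" and cnd_t_f: "cnd t x f = x"
    and cnd_cnd: "cnd x (cnd y z v) w = cnd (cnd x y w) z (cnd x v w)"
    and cnd_mem: "cnd x y (cnd z a (cnd v y w)) = cnd x y (cnd z a w)"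
    and cnd_swap: "cnd (cnd x y z) a (cnd v y w) = cnd (cnd x a v) y (cnd z a w)"
    and cnd_u: "cnd x u y = u"
    and neg_cnd: "\<sim> x = cnd f x t"
    and conj_cnd: "x \<sqinter> y = cnd y x f"
    and f_neg: "f = \<sim> t"
    and disj_neg: "x \<squnion> y = \<sim> (\<sim> x \<sqinter> \<sim> y)"
begin

lemma cnd_neg: "cnd x (\<sim> y) z = cnd z y x"
  by (simp add: neg_cnd cnd_t cnd_f cnd_cnd)

lemma disj_cnd: "x \<squnion> y = cnd t x y"
  by (simp add: disj_neg neg_cnd conj_cnd cnd_t cnd_f cnd_cnd cnd_t_f)

lemma neg_neg: "\<sim> \<sim> x = x"
  unfolding neg_cnd[of "\<sim> x"] cnd_neg by (rule cnd_t_f)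

lemma neg_conj: "\<sim> (x \<sqinter> y) = \<sim> x \<squnion> \<sim> y"
  by (simp add: disj_neg neg_neg)

lemma cnd_else: "cnd x y (cnd v y w) = cnd x y w"
  using cnd_mem[of x y x f v w] by (simp only: cnd_f)

text \<open>Negating the condition interchanges the branches and turns the memory axiom into its
  mirror image.\<close>

lemma cnd_mem_then: "cnd (cnd z a (cnd v y w)) y x = cnd (cnd z a v) y x"
  by (metis cnd_mem cnd_neg)

lemma conj_assoc: "(x \<sqinter> y) \<sqinter> z = x \<sqinter> (y \<sqinter> z)"
  by (simp add: conj_cnd cnd_cnd cnd_f)

lemma conj_disj: "x \<sqinter> (y \<squnion> z) = (x \<sqinter> y) \<squnion> (x \<sqinter> z)"
  by (simp add: disj_cnd conj_cnd cnd_cnd cnd_t cnd_f cnd_mem_then cnd_else)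

lemma disj_conj: "(x \<squnion> y) \<sqinter> z = (x \<sqinter> z) \<squnion> (\<sim> x \<sqinter> (y \<sqinter> z))"
  by (simp add: disj_cnd conj_cnd cnd_neg cnd_cnd cnd_t cnd_f cnd_t_f cnd_mem_then cnd_else)

lemma absorb: "x \<squnion> (x \<sqinter> y) = x"
  by (simp add: disj_cnd conj_cnd cnd_else cnd_t_f)

text \<open>A form suited to the commutativity law: with \<open>x\<close> read as
  \<open>cnd t x f\<close>, \<open>cnd_swap\<close> exchanges the roles of \<open>x\<close> and
  \<open>y\<close> in the right-hand side.\<close>

lemma conj_disj_conj_cnd: "(x \<sqinter> y) \<squnion> (y \<sqinter> x) = cnd x y (cnd f x f)"
proof -
  have "(x \<sqinter> y) \<squnion> (y \<sqinter> x) = cnd (cnd t y f) x (cnd x y f)"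
    by (simp add: disj_cnd conj_cnd cnd_cnd cnd_f cnd_else)
  also have "\<dots> = cnd (cnd t x x) y (cnd f x f)"
    by (rule cnd_swap)
  also have "cnd t x x = x"
    by (metis cnd_else cnd_t_f)
  finally show ?thesis .
qed

lemma conj_disj_comm: "(x \<sqinter> y) \<squnion> (y \<sqinter> x) = (y \<sqinter> x) \<squnion> (x \<sqinter> y)"
  using cnd_swap[of t x f y f f] by (simp only: conj_disj_conj_cnd cnd_t_f)

lemma t_conj: "t \<sqinter> x = x"
  by (simp add: conj_cnd cnd_t)

lemma neg_u: "\<sim> u = u"
  by (simp add: neg_cnd cnd_u)

end

section \<open>Algebras of the three-valued logic\<close>

locale cl3_algebra =
  fixes conj :: "'q \<Rightarrow> 'q \<Rightarrow> 'q" (infixr \<open>\<sqinter>\<close> 70) and disj (infixr \<open>\<squnion>\<close> 65)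
    and neg :: "'q \<Rightarrow> 'q" (\<open>\<sim> _\<close> [80] 80) and t f u :: 'q
  assumes neg_neg: "\<sim> \<sim> x = x" and neg_conj: "\<sim> (x \<sqinter> y) = \<sim> x \<squnion> \<sim> y"
    and conj_assoc: "(x \<sqinter> y) \<sqinter> z = x \<sqinter> (y \<sqinter> z)"
    and conj_disj: "x \<sqinter> (y \<squnion> z) = (x \<sqinter> y) \<squnion> (x \<sqinter> z)"
    and disj_conj: "(x \<squnion> y) \<sqinter> z = (x \<sqinter> z) \<squnion> (\<sim> x \<sqinter> (y \<sqinter> z))"
    and absorb: "x \<squnion> (x \<sqinter> y) = x"
    and conj_disj_comm: "(x \<sqinter> y) \<squnion> (y \<sqinter> x) = (y \<sqinter> x) \<squnion> (x \<sqinter> y)"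
    and t_conj: "t \<sqinter> x = x" and neg_t: "\<sim> t = f" and neg_u: "\<sim> u = u"
begin

lemma neg_disj: "\<sim> (x \<squnion> y) = \<sim> x \<sqinter> \<sim> y"
  by (metis neg_neg neg_conj)

text \<open>Negation is an involution that exchanges the two connectives and the two truth values
  and fixes \<open>u\<close>; hence every law below comes with its dual.\<close>

lemma dual_cl3_algebra: "cl3_algebra (\<squnion>) (\<sqinter>) neg f t u"
proof
  show "\<sim> \<sim> x = x" for x
    by (rule neg_neg)
  show "\<sim> (x \<squnion> y) = \<sim> x \<sqinter> \<sim> y" for x y
    by (rule neg_disj)
  show "(x \<squnion> y) \<squnion> z = x \<squnion> (y \<squnion> z)" for x y z
    by (metis neg_neg neg_conj conj_assoc neg_disj)
  show "x \<squnion> (y \<sqinter> z) = (x \<squnion> y) \<sqinter> (x \<squnion> z)" for x y z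
    by (metis neg_neg neg_conj conj_disj neg_disj)
  show "(x \<sqinter> y) \<squnion> z = (x \<squnion> z) \<sqinter> (\<sim> x \<squnion> (y \<squnion> z))" for x y z
    by (metis neg_neg neg_conj disj_conj neg_disj)
  show "x \<sqinter> (x \<squnion> y) = x" for x y
    by (metis neg_neg neg_conj absorb neg_disj)
  show "(x \<squnion> y) \<sqinter> (y \<squnion> x) = (y \<squnion> x) \<sqinter> (x \<squnion> y)" for x y
    by (metis neg_neg neg_conj conj_disj_comm neg_disj)
  show "f \<squnion> x = x" for x
    by (metis neg_neg neg_conj t_conj neg_t)
  show "\<sim> f = t"
    by (metis neg_neg neg_t)
  show "\<sim> u = u"
    by (rule neg_u)
qed

lemmas disj_assoc = cl3_algebra.conj_assoc[OF dual_cl3_algebra]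
  and disj_distrib = cl3_algebra.conj_disj[OF dual_cl3_algebra]
  and conj_disj_distrib = cl3_algebra.disj_conj[OF dual_cl3_algebra]
  and conj_absorb = cl3_algebra.absorb[OF dual_cl3_algebra]
  and disj_conj_comm = cl3_algebra.conj_disj_comm[OF dual_cl3_algebra]
  and f_disj = cl3_algebra.t_conj[OF dual_cl3_algebra]
  and neg_f = cl3_algebra.neg_t[OF dual_cl3_algebra]

section \<open>Idempotence, units and memory\<close>

lemma conj_idem: "x \<sqinter> x = x"
  by (metis absorb conj_absorb)

lemma disj_idem: "x \<squnion> x = x"
  by (metis absorb conj_absorb)

lemma f_conj: "f \<sqinter> x = f"
  by (metis absorb f_disj)

text \<open>That \<open>f\<close> is a left unit is the dual of \<open>t_conj\<close>; the dual of
  the commutativity axiom, applied to \<open>x\<close> and \<open>f\<close>, makes it a right unit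
  as well.\<close>

lemma disj_f: "x \<squnion> f = x"
proof -
  have "x \<squnion> f = (x \<squnion> f) \<sqinter> (x \<squnion> x)"
    using disj_distrib[of x f x] by (simp only: f_conj)
  also have "\<dots> = (f \<squnion> x) \<sqinter> (x \<squnion> f)"
    using disj_conj_comm[of x f] by (simp only: f_disj disj_idem)
  also have "\<dots> = x"
    by (simp only: f_disj conj_absorb)
  finally show ?thesis .
qed

lemma conj_t: "x \<sqinter> t = x"
  by (metis disj_f neg_neg neg_conj neg_t)

text \<open>Evaluation reaches \<open>y\<close> only after \<open>x\<close> has failed; formally
  this is \<open>disj_conj\<close> with \<open>z\<close> set to \<open>t\<close>.\<close>

lemma disj_memory: "x \<squnion> (\<sim> x \<sqinter> y) = x \<squnion> y"
  using disj_conj[of x y t] by (simp only: conj_t)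

lemma disj_neg_disj: "x \<squnion> (\<sim> x \<squnion> y) = x \<squnion> t"
  by (metis disj_memory conj_absorb conj_t)

end

context cl3_algebra
begin

lemmas t_disj = cl3_algebra.f_conj[OF dual_cl3_algebra]
  and conj_memory = cl3_algebra.disj_memory[OF dual_cl3_algebra]
  and conj_neg_conj = cl3_algebra.disj_neg_disj[OF dual_cl3_algebra]

text \<open>As \<open>u\<close> is its own negation, the memory law turns the left side into
  \<open>u \<sqinter> (u \<squnion> x)\<close>, which absorption reduces to
  \<open>u\<close>.\<close>

lemma u_conj: "u \<sqinter> x = u"
  by (metis conj_memory conj_absorb neg_u)

text \<open>Under the prefix \<open>x\<close>, absorption collapses each side of the commutativity
  axiom to its first disjunct.\<close>

lemma conj_repeat: "x \<sqinter> (y \<sqinter> x) = x \<sqinter> y"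
proof -
  have "x \<sqinter> y = x \<sqinter> ((x \<sqinter> y) \<squnion> (y \<sqinter> x))"
    by (metis conj_disj conj_assoc conj_idem absorb)
  also have "\<dots> = x \<sqinter> ((y \<sqinter> x) \<squnion> (x \<sqinter> y))"
    by (simp only: conj_disj_comm)
  also have "\<dots> = x \<sqinter> (y \<sqinter> x)"
    by (metis conj_disj conj_assoc conj_idem absorb)
  finally show ?thesis ..
qed

lemma conj_repeat_conj: "x \<sqinter> (y \<sqinter> (x \<sqinter> z)) = x \<sqinter> (y \<sqinter> z)"
  by (metis conj_repeat conj_assoc)

lemma conj_neg_conj_f: "x \<sqinter> (y \<sqinter> (\<sim> x \<sqinter> z)) = x \<sqinter> (y \<sqinter> f)"
  by (metis conj_repeat_conj conj_neg_conj)

section \<open>The definable conditional\<close>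

definition cnd :: "'q \<Rightarrow> 'q \<Rightarrow> 'q \<Rightarrow> 'q" where
  "cnd x y z = (y \<sqinter> x) \<squnion> (\<sim> y \<sqinter> z)"

lemma cnd_cnf: "cnd x y z = (y \<squnion> z) \<sqinter> (\<sim> y \<squnion> x)"
proof -
  \<comment> \<open>Under \<open>y\<close> the second disjunct reduces to \<open>f\<close>; the
    memory law then removes it from the clause that starts with \<open>\<sim> y\<close>.\<close>
  have "y \<sqinter> (x \<squnion> (\<sim> y \<sqinter> z)) = y \<sqinter> x"
    by (metis conj_disj conj_neg_conj disj_f)
  then have "\<sim> y \<squnion> (x \<squnion> (\<sim> y \<sqinter> z)) = \<sim> y \<squnion> x"
    by (metis disj_memory neg_neg)
  then show ?thesis
    by (simp only: cnd_def conj_disj_distrib disj_memory)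
qed

lemma cnd_neg: "cnd x (\<sim> y) z = cnd z y x"
proof -
  \<comment> \<open>In conjunctive form the two conditionals consist of the same two clauses in
    opposite order, so \<open>conj_repeat\<close> lets the first absorb the second. The disjunctive
    forms then show that their product commutes.\<close>
  have comm: "cnd p (\<sim> c) q = cnd p (\<sim> c) q \<sqinter> cnd q c p" for p q c
    by (simp only: cnd_cnf neg_neg conj_assoc)
       (metis conj_assoc conj_idem conj_repeat)
  have "cnd x (\<sim> y) z \<sqinter> cnd z y x = cnd z y x \<sqinter> cnd x (\<sim> y) z"
    using disj_conj_comm[of "\<sim> y \<sqinter> x" "y \<sqinter> z"] by (simp only: cnd_def neg_neg)
  then show ?thesis
    using comm[of x y z] comm[of z "\<sim> y" x] by (simp only: neg_neg)
qed

lemma neg_cnd: "\<sim> cnd x y z = cnd (\<sim> x) y (\<sim> z)"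
  using cnd_neg[of "\<sim> x" y "\<sim> z"] cnd_neg[of "\<sim> z" y "\<sim> x"]
  by (metis cnd_cnf cnd_def neg_conj neg_disj neg_neg)

lemma conj_cnd: "c \<sqinter> cnd x c y = c \<sqinter> x"
  by (metis cnd_def conj_disj conj_neg_conj conj_assoc conj_idem disj_f)

lemma neg_conj_cnd: "\<sim> c \<sqinter> cnd x c y = \<sim> c \<sqinter> y"
  by (metis conj_cnd cnd_neg)

lemma cnd_conj: "cnd x c y \<sqinter> w = cnd (x \<sqinter> w) c (y \<sqinter> w)"
proof -
  \<comment> \<open>Expansion leaves the extra disjunct
    \<open>c \<sqinter> (\<sim> x \<sqinter> f)\<close>, since \<open>x\<close> may be undefined.
    Exchanging branches with \<open>cnd_neg\<close> moves it next to
    \<open>c \<sqinter> (x \<sqinter> w)\<close>, where it disappears because \<open>x\<close> is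
    evaluated there anyway.\<close>
  have "\<sim> (c \<sqinter> x) \<sqinter> (\<sim> c \<sqinter> (y \<sqinter> w)) = (\<sim> c \<sqinter> (y \<sqinter> w)) \<squnion> (c \<sqinter> (\<sim> x \<sqinter> f))"
    by (simp only: neg_conj disj_conj neg_neg conj_neg_conj_f)
       (metis conj_assoc conj_idem)
  then have "cnd x c y \<sqinter> w = (c \<sqinter> (x \<sqinter> w)) \<squnion> ((\<sim> c \<sqinter> (y \<sqinter> w)) \<squnion> (c \<sqinter> (\<sim> x \<sqinter> f)))"
    by (simp only: cnd_def disj_conj conj_assoc)
  also have "\<dots> = (c \<sqinter> (x \<sqinter> w)) \<squnion> ((c \<sqinter> (\<sim> x \<sqinter> f)) \<squnion> (\<sim> c \<sqinter> (y \<sqinter> w)))"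
    using cnd_neg[of "y \<sqinter> w" c "\<sim> x \<sqinter> f"] by (simp only: cnd_def neg_neg)
  also have "\<dots> = (c \<sqinter> ((x \<sqinter> w) \<squnion> (\<sim> x \<sqinter> f))) \<squnion> (\<sim> c \<sqinter> (y \<sqinter> w))"
    by (simp only: conj_disj disj_assoc)
  also have "(x \<sqinter> w) \<squnion> (\<sim> x \<sqinter> f) = x \<sqinter> w"
    using cnd_cnf[of w x f] by (simp only: cnd_def disj_f conj_memory)
  finally show ?thesis
    by (simp only: cnd_def)
qed

lemma cnd_disj: "cnd x c y \<squnion> w = cnd (x \<squnion> w) c (y \<squnion> w)"
  by (metis cnd_conj neg_cnd neg_disj neg_neg)

lemma cnd_cong: "c \<sqinter> x = c \<sqinter> x' \<Longrightarrow> \<sim> c \<sqinter> y = \<sim> c \<sqinter> y' \<Longrightarrow> cnd x c y = cnd x' c y'"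
  by (simp only: cnd_def)

lemma cnd_disj_cnd: "cnd x c y \<squnion> cnd x' c y' = cnd (x \<squnion> x') c (y \<squnion> y')"
  unfolding cnd_disj by (rule cnd_cong) (simp_all only: conj_disj conj_cnd neg_conj_cnd)

lemma cnd_t: "cnd x t y = x"
  by (simp only: cnd_def t_conj neg_t f_conj disj_f)

lemma cnd_f: "cnd x f y = y"
  by (simp only: cnd_def t_conj neg_f f_conj f_disj)

lemma cnd_t_f: "cnd t x f = x"
  by (simp only: cnd_def conj_t disj_memory disj_f)

text \<open>Negation, conjunction with a right factor and disjunction all act branchwise on a
  conditional, so the defining formula can be pushed under the condition \<open>z\<close>.\<close>

lemma cnd_cnd: "cnd x (cnd y z v) w = cnd (cnd x y w) z (cnd x v w)"
  by (simp only: cnd_def[of x "cnd y z v"] neg_cnd cnd_conj cnd_disj_cnd)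
     (simp only: cnd_def)

text \<open>\<open>conj_repeat_conj\<close> repeats \<open>c\<close> in front of the innermost
  conditional, where it selects the branch \<open>w\<close>. The negated condition fits the
  else-branch in \<open>cnd_mem\<close>.\<close>

lemma conj_cnd_mem: "c \<sqinter> cnd z a (cnd v (\<sim> c) w) = c \<sqinter> cnd z a w"
proof -
  have "c \<sqinter> (\<sim> a \<sqinter> cnd v (\<sim> c) w) = c \<sqinter> (\<sim> a \<sqinter> w)"
    by (metis cnd_neg conj_cnd conj_repeat_conj)
  then show ?thesis
    by (simp only: cnd_def[of z a] conj_disj)
qed

lemma cnd_mem: "cnd x y (cnd z a (cnd v y w)) = cnd x y (cnd z a w)"
  using conj_cnd_mem[of "\<sim> y" z a v w] by (intro cnd_cong) (simp_all only: neg_neg)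

section \<open>Interchanging two conditions\<close>

lemma cnd_same: "cnd x c x = (c \<squnion> \<sim> c) \<sqinter> x"
  by (simp only: cnd_def disj_conj) (metis conj_assoc conj_idem)

text \<open>These elements have the form \<open>x \<squnion> t\<close>, so they and their products
  swallow every disjunct on their right. The commutativity axiom then equates the first disjuncts of
  its two sides.\<close>

lemma excluded_middle_comm:
  "(x \<squnion> \<sim> x) \<sqinter> (y \<squnion> \<sim> y) = (y \<squnion> \<sim> y) \<sqinter> (x \<squnion> \<sim> x)"
proof -
  have em: "x \<squnion> \<sim> x = x \<squnion> t" for x
    by (metis disj_memory conj_t)
  have top: "(x \<squnion> t) \<squnion> w = x \<squnion> t" for x w
    by (simp only: disj_assoc t_disj)
  have "((x \<squnion> t) \<sqinter> (y \<squnion> t)) \<squnion> w = (x \<squnion> t) \<sqinter> (y \<squnion> t)" for x y w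
    by (simp only: conj_disj_distrib top conj_memory)
  then show ?thesis
    by (metis conj_disj_comm em)
qed

lemma conj_cnd_swap: "y \<sqinter> cnd (cnd x y z) a (cnd v y w) = y \<sqinter> cnd x a v"
proof -
  have "y \<sqinter> (c \<sqinter> cnd p y q) = y \<sqinter> (c \<sqinter> p)" for c p q
    by (metis conj_cnd conj_repeat_conj)
  then show ?thesis
    by (simp only: cnd_def[of _ a] conj_disj)
qed

text \<open>By \<open>cnd_same\<close> the right-hand side is a conditional on \<open>y\<close> with
  equal branches; in each branch the value of \<open>y\<close> is known and resolves the inner
  conditionals.\<close>

lemma cnd_same_swap:
  "cnd (cnd x a v) y (cnd z a w) = (y \<squnion> \<sim> y) \<sqinter> cnd (cnd x y z) a (cnd v y w)"
  unfolding cnd_same[symmetric]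
  using conj_cnd_swap[of y x z a v w] conj_cnd_swap[of "\<sim> y" z x a w v]
  by (intro cnd_cong) (simp_all only: cnd_neg)

lemma cnd_swap: "cnd (cnd x y z) a (cnd v y w) = cnd (cnd x a v) y (cnd z a w)"
proof -
  let ?L = "cnd (cnd x y z) a (cnd v y w)" and ?R = "cnd (cnd x a v) y (cnd z a w)"
  let ?A = "a \<squnion> \<sim> a" and ?Y = "y \<squnion> \<sim> y"
  \<comment> \<open>Exchanging \<open>y\<close> with \<open>a\<close> and \<open>z\<close> with
    \<open>v\<close> interchanges \<open>?L\<close> and \<open>?R\<close>, so one lemma gives both
    equations.\<close>
  have R: "?R = ?Y \<sqinter> ?L" and L: "?L = ?A \<sqinter> ?R"
    by (rule cnd_same_swap)+
  have "?L = ?A \<sqinter> (?Y \<sqinter> ?L)"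
    by (metis L R)
  also have "\<dots> = ?Y \<sqinter> (?A \<sqinter> ?L)"
    by (metis excluded_middle_comm conj_assoc)
  also have "?A \<sqinter> ?L = ?L"
    by (metis L conj_assoc conj_idem)
  also note R[symmetric]
  finally show ?thesis .
qed

lemma cnd_u: "cnd x u y = u"
  by (simp only: cnd_def neg_u u_conj disj_idem)

lemma cnd_f_t: "cnd f x t = \<sim> x"
  by (metis cnd_neg cnd_t_f)

lemma cnd_conj_f: "cnd y x f = x \<sqinter> y"
  by (simp only: cnd_cnf disj_f conj_memory)

end

section \<open>Restricting the atoms of a derivation\<close>

text \<open>The quotients below admit all atoms of the type; this map brings derivations back to
  \<open>A\<close>. Foreign atoms become \<open>T\<close>, which is available even if
  \<open>A\<close> is empty.\<close>

primrec restrict_atoms :: "'a set \<Rightarrow> 'a trm \<Rightarrow> 'a trm" where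
  "restrict_atoms A (Var n) = Var n"
| "restrict_atoms A (Atom a) = (if a \<in> A then Atom a else T)"
| "restrict_atoms A T = T"
| "restrict_atoms A F = F"
| "restrict_atoms A U = U"
| "restrict_atoms A (\<^bold>\<not> s) = \<^bold>\<not> restrict_atoms A s"
| "restrict_atoms A (s \<^bold>\<and> t) = restrict_atoms A s \<^bold>\<and> restrict_atoms A t"
| "restrict_atoms A (s \<^bold>\<or> t) = restrict_atoms A s \<^bold>\<or> restrict_atoms A t"
| "restrict_atoms A (s \<lhd> t \<rhd> u) = restrict_atoms A s \<lhd> restrict_atoms A t \<rhd> restrict_atoms A u"

lemma atoms_restrict_atoms: "atoms (restrict_atoms A s) \<subseteq> A"
  by (induction s) auto

lemma cond_free_restrict_atoms: "cond_free (restrict_atoms A s) = cond_free s"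
  by (induction s) auto

lemma restrict_atoms_id: "atoms s \<subseteq> A \<Longrightarrow> restrict_atoms A s = s"
  by (induction s) auto

lemma restrict_atoms_subst:
  "atoms s = {} \<Longrightarrow> restrict_atoms A (subst \<sigma> s) = subst (restrict_atoms A \<circ> \<sigma>) s"
  by (induction s) auto

text \<open>Axioms without atoms treat atoms like variables, so replacing some of them throughout a
  derivation yields a derivation.\<close>

lemma derivable_restrict_atoms:
  assumes "derivable S E s t"
    and closed: "restrict_atoms A ` S \<subseteq> S'"
    and atom_free: "\<And>l r. (l, r) \<in> E \<Longrightarrow> atoms l = {} \<and> atoms r = {}"
  shows "derivable S' E (restrict_atoms A s) (restrict_atoms A t)"
  using assms(1)
proof (induction rule: derivable.induct)
  case (ax l r \<sigma>)
  then have "range (restrict_atoms A \<circ> \<sigma>) \<subseteq> S'"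
    using closed by auto
  with ax(1) have "derivable S' E (subst (restrict_atoms A \<circ> \<sigma>) l) (subst (restrict_atoms A \<circ> \<sigma>) r)"
    by (rule derivable.ax)
  then show ?case
    using atom_free[OF ax(1)] by (simp only: restrict_atoms_subst)
next
  case (cond s s' t t' u u')
  then have "restrict_atoms A (s \<lhd> t \<rhd> u) \<in> S'"
    using closed by blast
  with cond.IH show ?case
    by (simp add: derivable.cond)
qed (use closed in \<open>auto intro: derivable.intros\<close>)

lemma CL3_atom_free: "(l, r) \<in> CL3 \<Longrightarrow> atoms l = {} \<and> atoms r = {}"
  by (auto simp: CL3_def Let_def)

lemmas ClSCL_axioms_defs = ClSCL_axioms_def CP_cl_U_def CP_cl_def CP_mem_def CP_def

lemma ClSCL_atom_free: "(l, r) \<in> ClSCL_axioms \<Longrightarrow> atoms l = {} \<and> atoms r = {}"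
  by (auto simp: ClSCL_axioms_defs Let_def)

section \<open>Equations of conditional short-circuit logic hold in the three-valued logic\<close>

primrec expand_cond :: "'a trm \<Rightarrow> 'a trm" where
  "expand_cond (Var n) = Var n"
| "expand_cond (Atom a) = Atom a"
| "expand_cond T = T"
| "expand_cond F = F"
| "expand_cond U = U"
| "expand_cond (\<^bold>\<not> s) = \<^bold>\<not> expand_cond s"
| "expand_cond (s \<^bold>\<and> t) = expand_cond s \<^bold>\<and> expand_cond t"
| "expand_cond (s \<^bold>\<or> t) = expand_cond s \<^bold>\<or> expand_cond t"
| "expand_cond (s \<lhd> t \<rhd> u) =
    (expand_cond t \<^bold>\<and> expand_cond s) \<^bold>\<or> (\<^bold>\<not> expand_cond t \<^bold>\<and> expand_cond u)"

lemma cond_free_expand_cond: "cond_free (expand_cond s)"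
  by (induction s) auto

lemma expand_cond_id: "cond_free s \<Longrightarrow> expand_cond s = s"
  by (induction s) auto

lemma expand_cond_in_scl_terms: "expand_cond s \<in> scl_terms UNIV"
  by (simp add: scl_terms_def cond_free_expand_cond)

text \<open>Pulling derivability back along \<open>expand_cond\<close> makes it reflexive on all
  terms, also on those with conditionals, so that a total quotient exists.\<close>

definition cl3_eq :: "'a trm \<Rightarrow> 'a trm \<Rightarrow> bool" where
  "cl3_eq s t \<longleftrightarrow> derivable (scl_terms UNIV) CL3 (expand_cond s) (expand_cond t)"

quotient_type 'a cl3_term = "'a trm" / cl3_eq
proof (rule equivpI)
  show "reflp cl3_eq"
    by (auto simp: reflp_def cl3_eq_def intro: derivable.refl expand_cond_in_scl_terms)
  show "symp cl3_eq"
    by (auto simp: symp_def cl3_eq_def intro: derivable.sym)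
  show "transp cl3_eq"
    by (auto simp: transp_def cl3_eq_def intro: derivable.trans)
qed

lift_definition cl3_neg :: "'a cl3_term \<Rightarrow> 'a cl3_term" is Neg
  by (simp add: cl3_eq_def derivable.neg)

lift_definition cl3_conj :: "'a cl3_term \<Rightarrow> 'a cl3_term \<Rightarrow> 'a cl3_term" is And
  by (simp add: cl3_eq_def derivable.conj)

lift_definition cl3_disj :: "'a cl3_term \<Rightarrow> 'a cl3_term \<Rightarrow> 'a cl3_term" is Or
  by (simp add: cl3_eq_def derivable.disj)

lift_definition cl3_T :: "'a cl3_term" is T .
lift_definition cl3_F :: "'a cl3_term" is F .
lift_definition cl3_U :: "'a cl3_term" is U .

lemma expand_cond_subst:
  "cond_free s \<Longrightarrow> expand_cond (subst \<sigma> s) = subst (expand_cond \<circ> \<sigma>) s"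
  by (induction s) auto

lemma CL3_cond_free: "(l, r) \<in> CL3 \<Longrightarrow> cond_free l \<and> cond_free r"
  by (auto simp: CL3_def Let_def)

lemma cl3_eq_axiom:
  assumes "(l, r) \<in> CL3"
  shows "cl3_eq (subst \<sigma> l) (subst \<sigma> r)"
proof -
  have "range (expand_cond \<circ> \<sigma>) \<subseteq> scl_terms UNIV"
    using expand_cond_in_scl_terms by auto
  with assms have "derivable (scl_terms UNIV) CL3
      (subst (expand_cond \<circ> \<sigma>) l) (subst (expand_cond \<circ> \<sigma>) r)"
    by (rule derivable.ax)
  then show ?thesis
    using CL3_cond_free[OF assms] by (simp only: cl3_eq_def expand_cond_subst)
qed

lemma cl3_term_cl3_algebra:
  "cl3_algebra cl3_conj cl3_disj cl3_neg cl3_T cl3_F (cl3_U :: 'a cl3_term)"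
proof -
  \<comment> \<open>The axioms are instantiated at their variables 0, 1 and 2; \<open>T\<close> only
    makes the substitution total.\<close>
  have "\<forall>(l, r) \<in> CL3. cl3_eq (subst ((\<lambda>_. T)(0 := x, 1 := y, 2 := z)) l)
      (subst ((\<lambda>_. T)(0 := x, 1 := y, 2 := z)) r)" for x y z :: "'a trm"
    using cl3_eq_axiom by blast
  note eqs = this[unfolded CL3_def Let_def, simplified]
  show ?thesis
    by unfold_locales (transfer; simp add: eqs)+
qed

interpretation cl3: cl3_algebra cl3_conj cl3_disj cl3_neg cl3_T cl3_F cl3_U
  by (rule cl3_term_cl3_algebra)

text \<open>\<open>expand_cond\<close> maps the conditional and its defining formula to the very
  same term, so reflexivity suffices.\<close>

lemma abs_cl3_term_cond:
  "abs_cl3_term (s \<lhd> t \<rhd> u) = cl3.cnd (abs_cl3_term s) (abs_cl3_term t) (abs_cl3_term u)"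
proof -
  have "abs_cl3_term (s \<lhd> t \<rhd> u) = abs_cl3_term ((t \<^bold>\<and> s) \<^bold>\<or> (\<^bold>\<not> t \<^bold>\<and> u))"
    unfolding cl3_term.abs_eq_iff cl3_eq_def expand_cond.simps
    using expand_cond_in_scl_terms[of "s \<lhd> t \<rhd> u"] by (auto intro: derivable.refl)
  then show ?thesis
    by (simp add: cl3.cnd_def cl3_neg.abs_eq cl3_conj.abs_eq cl3_disj.abs_eq)
qed

lemmas abs_cl3_term_simps = abs_cl3_term_cond
  cl3_neg.abs_eq[symmetric] cl3_conj.abs_eq[symmetric] cl3_disj.abs_eq[symmetric]
  cl3_T.abs_eq[symmetric] cl3_F.abs_eq[symmetric] cl3_U.abs_eq[symmetric]

lemma ClSCL_sound_cl3_term: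
  "derivable S ClSCL_axioms s t \<Longrightarrow> abs_cl3_term s = abs_cl3_term t"
proof (induction rule: derivable.induct)
  case (ax l r \<sigma>)
  then show ?case
    by (auto simp: ClSCL_axioms_defs Let_def abs_cl3_term_simps cl3.cnd_t cl3.cnd_f cl3.conj_t
        cl3.cnd_cnd cl3.cnd_mem cl3.cnd_swap cl3.cnd_u cl3.cnd_f_t cl3.cnd_conj_f
        cl3.neg_t cl3.neg_conj cl3.neg_neg)
qed (simp_all add: abs_cl3_term_simps)

lemma ClSCL_imp_CL3:
  assumes "s \<in> scl_terms A" "t \<in> scl_terms A" "derivable S ClSCL_axioms s t"
  shows "derivable (scl_terms A) CL3 s t"
proof -
  \<comment> \<open>The endpoints contain no conditional, so \<open>expand_cond\<close> fixes them
    and equality of classes is a \<open>CL3\<close> derivation; it remains to confine its atoms to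
    \<open>A\<close>.\<close>
  have "derivable (scl_terms UNIV) CL3 s t"
    using assms ClSCL_sound_cl3_term[OF assms(3)]
    by (simp add: cl3_term.abs_eq_iff cl3_eq_def scl_terms_def expand_cond_id)
  then have "derivable (scl_terms A) CL3 (restrict_atoms A s) (restrict_atoms A t)"
    by (rule derivable_restrict_atoms)
       (auto simp: scl_terms_def cond_free_restrict_atoms CL3_atom_free
         dest: subsetD[OF atoms_restrict_atoms] CL3_atom_free)
  with assms show ?thesis
    by (simp add: scl_terms_def restrict_atoms_id)
qed

section \<open>Equations of the three-valued logic hold in conditional short-circuit logic\<close>

text \<open>With the conditional in the signature, derivability is a congruence on all terms, and no
  translation precedes the quotient.\<close>

definition cond_eq :: "'a trm \<Rightarrow> 'a trm \<Rightarrow> bool" where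
  "cond_eq = derivable UNIV ClSCL_axioms"

quotient_type 'a cond_term = "'a trm" / cond_eq
  unfolding cond_eq_def
  by (rule equivpI)
     (auto simp: reflp_def symp_def transp_def
       intro: derivable.refl derivable.sym derivable.trans)

lift_definition cond_neg :: "'a cond_term \<Rightarrow> 'a cond_term" is Neg
  by (simp add: cond_eq_def derivable.neg)

lift_definition cond_conj :: "'a cond_term \<Rightarrow> 'a cond_term \<Rightarrow> 'a cond_term" is And
  by (simp add: cond_eq_def derivable.conj)

lift_definition cond_disj :: "'a cond_term \<Rightarrow> 'a cond_term \<Rightarrow> 'a cond_term" is Or
  by (simp add: cond_eq_def derivable.disj)

lift_definition cond_cond :: "'a cond_term \<Rightarrow> 'a cond_term \<Rightarrow> 'a cond_term \<Rightarrow> 'a cond_term" is Cond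
  by (simp add: cond_eq_def derivable.cond)

lift_definition cond_T :: "'a cond_term" is T .
lift_definition cond_F :: "'a cond_term" is F .
lift_definition cond_U :: "'a cond_term" is U .

lemma cond_term_cond_algebra:
  "cond_algebra cond_cond cond_T cond_F (cond_U :: 'a cond_term) cond_neg cond_conj cond_disj"
proof -
  have "\<forall>(l, r) \<in> ClSCL_axioms.
      cond_eq (subst ((\<lambda>_. T)(0 := x, 1 := y, 2 := z, 3 := u, 4 := v, 5 := w)) l)
        (subst ((\<lambda>_. T)(0 := x, 1 := y, 2 := z, 3 := u, 4 := v, 5 := w)) r)"
    for x y z u v w :: "'a trm"
    by (auto simp: cond_eq_def intro: derivable.ax)
  note eqs = this[unfolded ClSCL_axioms_defs Let_def, simplified]
  show ?thesis
    by unfold_locales (transfer; simp add: eqs)+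
qed

interpretation cond: cond_algebra cond_cond cond_T cond_F cond_U cond_neg cond_conj cond_disj
  by (rule cond_term_cond_algebra)

lemmas abs_cond_term_simps =
  cond_neg.abs_eq[symmetric] cond_conj.abs_eq[symmetric] cond_disj.abs_eq[symmetric]
  cond_cond.abs_eq[symmetric]
  cond_T.abs_eq[symmetric] cond_F.abs_eq[symmetric] cond_U.abs_eq[symmetric]

lemma CL3_sound_cond_term:
  "derivable S CL3 s t \<Longrightarrow> abs_cond_term s = abs_cond_term t"
proof (induction rule: derivable.induct)
  case (ax l r \<sigma>)
  then show ?case
    by (auto simp: CL3_def Let_def abs_cond_term_simps cond.neg_neg cond.neg_conj cond.conj_assoc
        cond.conj_disj cond.disj_conj cond.absorb cond.t_conj cond.neg_u cond.f_neg[symmetric]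
        intro: cond.conj_disj_comm)
qed (simp_all add: abs_cond_term_simps)

lemma CL3_imp_ClSCL:
  assumes "s \<in> scl_terms A" "t \<in> scl_terms A" "derivable S CL3 s t"
  shows "derivable (cond_terms A) ClSCL_axioms s t"
proof -
  \<comment> \<open>This derivation may use any atom; restriction to \<open>A\<close> repairs that
    and fixes both endpoints.\<close>
  have "derivable UNIV ClSCL_axioms s t"
    using CL3_sound_cond_term[OF assms(3)] by (simp only: cond_term.abs_eq_iff cond_eq_def)
  then have "derivable (cond_terms A) ClSCL_axioms (restrict_atoms A s) (restrict_atoms A t)"
    by (rule derivable_restrict_atoms)
       (auto simp: cond_terms_def dest: subsetD[OF atoms_restrict_atoms] ClSCL_atom_free)
  with assms show ?thesis
    by (simp add: scl_terms_def restrict_atoms_id)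
qed

theorem theorem4p10:
  fixes A :: "'a set" and s t :: "'a trm"
  assumes "s \<in> scl_terms A" and "t \<in> scl_terms A"
  shows "CL3_derives A s t \<longleftrightarrow> ClSCL_derives A s t"
  using assms ClSCL_imp_CL3 CL3_imp_ClSCL
  unfolding CL3_derives_def ClSCL_derives_def by blast

end
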